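(* Let $k$ and $t$ be integers with $k=\binom{t}{2}\ge 6$, and let $H$ be a graph with $|E(H)|\ge 4$ that is a subgraph of the balanced complete $(k-3)$-partite graph $K_{(k-3)\times 2}$. Then $$\operatorname{GM}_{k-2}(K_{1,3}:H)=\begin{cases}1, & t=4;\\ 14, & t=5;\\ (t-3)\binom{t-1}{3}+3\binom{t-3}{3}+6\binom{t-3}{2}, & t\ge 6.\end{cases}$$
   Context: All graphs are finite, simple and without isolated vertices. A $k$-edge-coloring of a graph is a map from its edge set onto $\{1,\dots,k\}$ that is exact, i.e. every one of the $k$ colors is used at least once. An edge-colored graph is rainbow if all its edges have distinct colors and monochromatic if all its edges have the same color. A copy of a graph $F$ in a graph $G$ is a subgraph of $G$ isomorphic to $F$; distinct copies are distinct subgraphs. $K_{(m)\times 2}$ denotes the complete $m$-partite graph with every part of size $2$. For non-empty graphs $G,H$ and a positive integer $k$, the Gallai-Ramsey number $\operatorname{gr}_k(G:H)$ is the minimum integer $N$ such that for all $n\ge N$, every (exact) $k$-edge-coloring of $K_n$ contains a rainbow copy of $G$ or a monochromatic copy of $H$. The Gallai-Ramsey multiplicity $\operatorname{GM}_k(G:H)$ is the minimum, over all (exact) $k$-edge-colorings of $K_{\operatorname{gr}_k(G:H)}$, of the total number of rainbow copies of $G$ plus monochromatic copies of $H$.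
   Formalization: The Gallai-Ramsey number is taken as the minimum N for which an exact coloring of K_N with the given number of colors exists; read literally, small N satisfy the condition vacuously and the multiplicity would be a minimum over an empty set. *)

theory Defs
  imports Complex_Main "HOL-Library.Ramsey"
begin

text \<open>Edges are two-element sets of vertices; \<^term>\<open>nsets V 2\<close> is the set of
  all two-element subsets of \<^term>\<open>V\<close>.\<close>

datatype 'a graph = Graph (verts: "'a set") (edges: "'a set set")

definition simple_graph :: "'a graph \<Rightarrow> bool" where
  "simple_graph G \<longleftrightarrow> finite (verts G) \<and> edges G \<subseteq> nsets (verts G) 2"

definition no_isolated_vertices :: "'a graph \<Rightarrow> bool" where
  "no_isolated_vertices G \<longleftrightarrow> (\<forall>v\<in>verts G. \<exists>e\<in>edges G. v \<in> e)"

definition subgraph :: "'a graph \<Rightarrow> 'a graph \<Rightarrow> bool" where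
  "subgraph F G \<longleftrightarrow> simple_graph F \<and> verts F \<subseteq> verts G \<and> edges F \<subseteq> edges G"

definition graph_iso :: "'a graph \<Rightarrow> 'b graph \<Rightarrow> bool" where
  "graph_iso F G \<longleftrightarrow>
    (\<exists>f. bij_betw f (verts F) (verts G) \<and> (\<lambda>e. f ` e) ` edges F = edges G)"

definition copies :: "'a graph \<Rightarrow> 'b graph \<Rightarrow> 'b graph set" where
  "copies F G = {S. subgraph S G \<and> graph_iso F S}"

definition complete_graph :: "nat \<Rightarrow> nat graph" where
  "complete_graph n = Graph {..<n} (nsets {..<n} 2)"

text \<open>The star $K_{1,m}$, with centre 0.\<close>

definition star_graph :: "nat \<Rightarrow> nat graph" where
  "star_graph m = Graph {0..m} ((\<lambda>i. {0, i}) ` {1..m})"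

text \<open>The complete multipartite graph with \<^term>\<open>m\<close> parts of size \<^term>\<open>s\<close>;
  the first component of a vertex is the index of its part.\<close>

definition complete_multipartite :: "nat \<Rightarrow> nat \<Rightarrow> (nat \<times> nat) graph" where
  "complete_multipartite m s =
    Graph ({..<m} \<times> {..<s})
      {{u, v} |u v. u \<in> {..<m} \<times> {..<s} \<and> v \<in> {..<m} \<times> {..<s} \<and> fst u \<noteq> fst v}"

text \<open>Only the values of a colouring on the edges of the graph matter.\<close>

definition exact_coloring :: "nat \<Rightarrow> 'a graph \<Rightarrow> ('a set \<Rightarrow> nat) \<Rightarrow> bool" where
  "exact_coloring k G c \<longleftrightarrow> c ` edges G = {1..k}"

definition rainbow :: "('a set \<Rightarrow> nat) \<Rightarrow> 'a graph \<Rightarrow> bool" where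
  "rainbow c F \<longleftrightarrow> inj_on c (edges F)"

definition monochromatic :: "('a set \<Rightarrow> nat) \<Rightarrow> 'a graph \<Rightarrow> bool" where
  "monochromatic c F \<longleftrightarrow> (\<exists>i. \<forall>e\<in>edges F. c e = i)"

definition rainbow_copies :: "('b set \<Rightarrow> nat) \<Rightarrow> 'a graph \<Rightarrow> 'b graph \<Rightarrow> 'b graph set" where
  "rainbow_copies c F G = {S \<in> copies F G. rainbow c S}"

definition mono_copies :: "('b set \<Rightarrow> nat) \<Rightarrow> 'a graph \<Rightarrow> 'b graph \<Rightarrow> 'b graph set" where
  "mono_copies c F G = {S \<in> copies F G. monochromatic c S}"

text \<open>The first conjunct makes explicit the usual convention that the complete graph
  on $N$ vertices has at least \<^term>\<open>k\<close> edges. Without it, values of $N$ for which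
  no exact colouring exists would satisfy the condition at $N$ vacuously, and the multiplicity
  below could be a minimum over the empty set.\<close>

definition gallai_ramsey :: "nat \<Rightarrow> 'a graph \<Rightarrow> 'b graph \<Rightarrow> nat" where
  "gallai_ramsey k G H =
    (LEAST N. (\<exists>c. exact_coloring k (complete_graph N) c) \<and>
       (\<forall>n\<ge>N. \<forall>c. exact_coloring k (complete_graph n) c \<longrightarrow>
          rainbow_copies c G (complete_graph n) \<noteq> {} \<or>
          mono_copies c H (complete_graph n) \<noteq> {}))"

definition gallai_ramsey_mult :: "nat \<Rightarrow> 'a graph \<Rightarrow> 'b graph \<Rightarrow> nat" where
  "gallai_ramsey_mult k G H =
    (let K = complete_graph (gallai_ramsey k G H) in
     LEAST m. \<exists>c. exact_coloring k K c \<and>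
       m = card (rainbow_copies c G K) + card (mono_copies c H K))"

end

theory Submission
  imports Defs
begin

text \<open>A colouring without rainbow $K_{1,3}$ shows at most two colours at every vertex, and the
  colour sets of any two vertices meet. With at least four colours this forces one colour \<open>a\<close>
  seen by every vertex; choosing an edge of each other colour then gives a complete multipartite
  graph with parts of size 2 in colour \<open>a\<close>, hence a monochromatic \<open>H\<close>. So the Gallai-Ramsey number
  is the least order with enough edges for \<open>k - 2\<close> colours, which is \<open>t\<close>. On \<open>K\<^sub>t\<close> there are
  just two more edges than colours: no colour is used four times, and at most three pairs of edges
  are monochromatic. Each such pair spoils at most \<open>t - 3\<close> stars, and a monochromatic triangle
  attains the bound \<open>3 (t - 3)\<close>.\<close>

section \<open>Stars in complete graphs\<close>

definition star_on :: "'a \<Rightarrow> 'a set \<Rightarrow> 'a graph" where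
  "star_on v T = Graph (insert v T) ((\<lambda>x. {v, x}) ` T)"

text \<open>Pairs of centre and leaf set, which are easier to count than subgraphs. For
  \<open>2 \<le> m\<close> they index the copies of the star one-to-one; for \<open>m = 1\<close>
  every edge arises from both of its ends.\<close>

definition stars :: "nat \<Rightarrow> nat \<Rightarrow> (nat \<times> nat set) set" where
  "stars m n = (SIGMA v:{..<n}. nsets ({..<n} - {v}) m)"

lemma finite_stars: "finite (stars m n)"
  unfolding stars_def by (intro finite_SigmaI finite_imp_finite_nsets) auto

lemma card_stars: "card (stars m n) = n * ((n - 1) choose m)"
proof -
  have "card (stars m n) = (\<Sum>v<n. card (nsets ({..<n} - {v}) m))"
    unfolding stars_def by (intro card_SigmaI ballI finite_imp_finite_nsets) auto
  also have "\<dots> = (\<Sum>v<n. (n - 1) choose m)"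
    by (intro sum.cong) (auto simp: card_nsets)
  finally show ?thesis by simp
qed

lemma two_distinct_elements:
  assumes "2 \<le> card A"
  obtains x y where "x \<in> A" "y \<in> A" "x \<noteq> y"
proof -
  obtain D where "D \<subseteq> A" "card D = 2"
    using assms by (rule obtain_subset_with_card_n)
  then show ?thesis using that by (auto simp: card_2_iff)
qed

text \<open>Two distinct edges of a star share only the centre, so a star with at least two leaves
  determines its centre and then its leaf set.\<close>

lemma star_on_inject:
  assumes eq: "star_on v T = star_on w U"
    and v: "v \<notin> T" and w: "w \<notin> U" and T: "2 \<le> card T"
  shows "v = w \<and> T = U"
proof -
  from T obtain x y where xy: "x \<in> T" "y \<in> T" "x \<noteq> y"
    by (elim two_distinct_elements)
  have E: "(\<lambda>x. {v, x}) ` T = (\<lambda>x. {w, x}) ` U" and V: "insert v T = insert w U"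
    using eq unfolding star_on_def by auto
  have "w \<in> {v, x}" "w \<in> {v, y}"
    using E xy by (metis (no_types, lifting) imageE image_eqI insertI1)+
  then have "v = w" using xy by auto
  with V v w show ?thesis by (metis insert_ident)
qed

lemma inj_on_star_on:
  assumes "2 \<le> m"
  shows "inj_on (\<lambda>(v, T). star_on v T) (stars m n)"
proof (rule inj_onI, clarify)
  fix v T w U
  assume a: "(v, T) \<in> stars m n" "(w, U) \<in> stars m n" "star_on v T = star_on w U"
  then show "v = w \<and> T = U"
    using assms by (intro star_on_inject) (auto simp: stars_def nsets_def)
qed

lemma copies_star_graph:
  "copies (star_graph m) (complete_graph n) = (\<lambda>(v, T). star_on v T) ` stars m n"
proof (intro equalityI subsetI)
  fix S assume "S \<in> copies (star_graph m) (complete_graph n)"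
  then obtain f where S: "simple_graph S" "verts S \<subseteq> {..<n}"
    and f: "bij_betw f {0..m} (verts S)"
    and E: "(\<lambda>e. f ` e) ` (\<lambda>i. {0, i}) ` {1..m} = edges S"
    unfolding copies_def subgraph_def graph_iso_def star_graph_def complete_graph_def by auto
  define T where "T = f ` {1..m}"
  have inj: "inj_on f {0..m}" and im: "f ` {0..m} = verts S"
    using f by (auto simp: bij_betw_def)
  have "{0..m} = insert 0 {1..m}" by auto
  then have V: "verts S = insert (f 0) T"
    using im unfolding T_def by (metis image_insert)
  have "f 0 \<notin> T" using inj unfolding T_def inj_on_def by force
  moreover have "card T = m"
    using card_image[OF inj_on_subset[OF inj, of "{1..m}"]] unfolding T_def by auto
  ultimately have "(f 0, T) \<in> stars m n"
    using S(2) V T_def unfolding stars_def nsets_def by (simp add: subset_Diff_insert)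
  moreover have "edges S = (\<lambda>x. {f 0, x}) ` T"
    unfolding E[symmetric] T_def by (auto simp: image_image)
  then have "S = star_on (f 0) T"
    using V unfolding star_on_def by (metis graph.collapse)
  ultimately show "S \<in> (\<lambda>(v, T). star_on v T) ` stars m n" by force
next
  fix S assume "S \<in> (\<lambda>(v, T). star_on v T) ` stars m n"
  then obtain v T where S: "S = star_on v T" and v: "v < n"
    and T: "T \<subseteq> {..<n} - {v}" "finite T" "card T = m"
    unfolding stars_def nsets_def by auto
  obtain h where h: "bij_betw h {1..m} T"
    using T finite_same_card_bij[of "{1..m}" T] by auto
  \<comment> \<open>\<open>h\<close> matches the numbered leaves with \<open>T\<close>; overwriting
    its value at 0 sends the centre of \<open>star_graph m\<close> to \<open>v\<close>.\<close>
  define f where "f = h(0 := v)"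
  have him: "h ` {1..m} = T" and hinj: "inj_on h {1..m}"
    using h by (auto simp: bij_betw_def)
  have fh: "f ` {1..m} = T" "inj_on f {1..m}"
  proof -
    show "f ` {1..m} = T"
      unfolding him[symmetric] f_def by (intro image_cong) auto
    show "inj_on f {1..m}"
      using hinj inj_on_cong[of "{1..m}" f h] unfolding f_def by simp
  qed
  have ins: "{0..m} = insert 0 {1..m}" by auto
  have "bij_betw f {0..m} (insert v T)"
    unfolding ins bij_betw_def using fh T by (auto simp: f_def)
  moreover have "(\<lambda>e. f ` e) ` (\<lambda>i. {0, i}) ` {1..m} = (\<lambda>x. {v, x}) ` f ` {1..m}"
    unfolding image_image by (intro image_cong) (auto simp: f_def)
  ultimately have "graph_iso (star_graph m) S"
    unfolding graph_iso_def S star_on_def star_graph_def fh graph.sel by blast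
  moreover have "subgraph S (complete_graph n)"
    unfolding subgraph_def simple_graph_def S star_on_def complete_graph_def
    using T v by (auto simp: nsets_def card_insert_if)
  ultimately show "S \<in> copies (star_graph m) (complete_graph n)"
    unfolding copies_def by simp
qed

text \<open>Two edges of a common star fix its centre, their common end, and two of its three
  leaves. Only the third leaf is free, among the \<open>n - 3\<close> remaining vertices.\<close>

lemma card_stars_containing_two_edges:
  assumes "e \<noteq> f"
  shows "card {(v, T) \<in> stars 3 n. {e, f} \<subseteq> edges (star_on v T)} \<le> n - 3" (is "card ?B \<le> _")
proof (cases "?B = {}")
  case False
  then obtain v T where vT: "(v, T) \<in> stars 3 n" "{e, f} \<subseteq> edges (star_on v T)" by auto
  then obtain x y where xy: "e = {v, x}" "f = {v, y}" "x \<in> T" "y \<in> T"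
    unfolding star_on_def by auto
  have ne: "x \<noteq> y" "x \<noteq> v" "y \<noteq> v" and lt: "x < n" "y < n" "v < n"
    using xy assms vT unfolding stars_def nsets_def by auto
  have "?B \<subseteq> (\<lambda>z. (v, {x, y, z})) ` ({..<n} - {v, x, y})"
  proof clarify
    fix w U assume U: "(w, U) \<in> stars 3 n" "{e, f} \<subseteq> edges (star_on w U)"
    then obtain x' y' where xy': "e = {w, x'}" "f = {w, y'}" "x' \<in> U" "y' \<in> U"
      unfolding star_on_def by auto
    have w: "w = v" using xy xy' ne by (metis doubleton_eq_iff)
    then have in_U: "x \<in> U" "y \<in> U" using xy xy' by (metis doubleton_eq_iff)+
    have Un: "U \<subseteq> {..<n} - {v}" "card U = 3" "finite U"
      using U w unfolding stars_def nsets_def by auto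
    have "card (U - {x, y}) = 1" using Un in_U ne by (simp add: card_Diff_subset)
    then obtain z where z: "U - {x, y} = {z}" by (meson card_1_singletonE)
    then have "U = {x, y, z}" using in_U by auto
    moreover have "z \<in> {..<n} - {v, x, y}" using z Un by auto
    ultimately show "(w, U) \<in> (\<lambda>z. (v, {x, y, z})) ` ({..<n} - {v, x, y})"
      using w by auto
  qed
  then have "card ?B \<le> card ({..<n} - {v, x, y})"
    by (rule surj_card_le[rotated]) auto
  also have "\<dots> = n - 3" using ne lt by (auto simp: card_Diff_subset)
  finally show ?thesis .
next
  case True
  then show ?thesis by (simp only: card.empty)
qed

section \<open>Rainbow-free colourings\<close>

text \<open>Pairwise intersecting sets of at most two elements form a star or a triangle, and a
  triangle covers only three elements.\<close>

lemma common_element_of_intersecting_pairs: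
  assumes W: "W \<noteq> {}"
    and fin: "\<And>w. w \<in> W \<Longrightarrow> finite (C w)"
    and le2: "\<And>w. w \<in> W \<Longrightarrow> card (C w) \<le> 2"
    and meet: "\<And>u w. u \<in> W \<Longrightarrow> w \<in> W \<Longrightarrow> C u \<inter> C w \<noteq> {}"
    and four: "4 \<le> card (\<Union>w\<in>W. C w)"
  shows "\<exists>a. \<forall>w\<in>W. a \<in> C w"
proof (rule ccontr)
  assume no: "\<not> ?thesis"
  define U where "U = (\<Union>w\<in>W. C w)"
  have finU: "finite U" using four card.infinite unfolding U_def by fastforce
  have no3: False if "w \<in> W" "x \<in> C w" "y \<in> C w" "z \<in> C w" "x \<noteq> y" "x \<noteq> z" "y \<noteq> z" for w x y z
    using card_mono[of "C w" "{x, y, z}"] fin[of w] le2[of w] that by auto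
  obtain u where u: "u \<in> W" using W by auto
  \<comment> \<open>\<open>C u\<close> covers at most two of at least four elements. Two others,
    \<open>d\<close> and \<open>e\<close>, lie in sets \<open>C v\<close> and \<open>C w\<close>
    that must also meet \<open>C u\<close>.\<close>
  have "card (U - C u) \<ge> 2"
    using four le2[OF u] diff_card_le_card_Diff[OF fin[OF u], of U] unfolding U_def by linarith
  then obtain d e where de: "d \<in> U - C u" "e \<in> U - C u" "d \<noteq> e"
    by (elim two_distinct_elements)
  obtain v w where vw: "v \<in> W" "d \<in> C v" "w \<in> W" "e \<in> C w" using de unfolding U_def by auto
  obtain a where a: "a \<in> C u" "a \<in> C v" using meet[OF u vw(1)] by auto
  have ad: "a \<noteq> d" "a \<noteq> e" using a de by auto
  \<comment> \<open>Here \<open>C v = {a, d}\<close>. If \<open>C w\<close> missed \<open>a\<close>,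
    it would meet \<open>C v\<close> in \<open>d\<close>, and so contain \<open>d\<close>,
    \<open>e\<close> and an element of \<open>C u\<close>: three elements.\<close>
  have aw: "a \<in> C w"
  proof (rule ccontr)
    assume "a \<notin> C w"
    obtain x where x: "x \<in> C v" "x \<in> C w" using meet[OF vw(1,3)] by auto
    obtain y where y: "y \<in> C u" "y \<in> C w" using meet[OF u vw(3)] by auto
    have "x = d" using no3[OF vw(1), of a d x] a vw x ad \<open>a \<notin> C w\<close> by auto
    then show False using no3[OF vw(3), of d e y] x y vw de by auto
  qed
  \<comment> \<open>A set missing \<open>a\<close> must meet \<open>C v = {a, d}\<close> in
    \<open>d\<close> and \<open>C w = {a, e}\<close> in \<open>e\<close>; with its element
    \<open>p\<close> of \<open>C u\<close> it would have three elements.\<close>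
  obtain z where z: "z \<in> W" "a \<notin> C z" using no by auto
  obtain p where p: "p \<in> C u" "p \<in> C z" using meet[OF u z(1)] by auto
  obtain q where q: "q \<in> C v" "q \<in> C z" using meet[OF vw(1) z(1)] by auto
  obtain r where r: "r \<in> C w" "r \<in> C z" using meet[OF vw(3) z(1)] by auto
  have "q = d" using no3[OF vw(1), of a d q] a vw q ad z by auto
  moreover have "r = e" using no3[OF vw(3), of a e r] aw vw r ad z by auto
  ultimately show False using no3[OF z(1), of p d e] p q r de by auto
qed

lemma rainbow_star_3I:
  assumes "v < n" "x < n" "y < n" "z < n" "v \<notin> {x, y, z}"
    and "c {v, x} \<noteq> c {v, y}" "c {v, x} \<noteq> c {v, z}" "c {v, y} \<noteq> c {v, z}"
  shows "star_on v {x, y, z} \<in> rainbow_copies c (star_graph 3) (complete_graph n)"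
proof -
  have "x \<noteq> y" "x \<noteq> z" "y \<noteq> z" using assms by auto
  then have "(v, {x, y, z}) \<in> stars 3 n"
    using assms unfolding stars_def nsets_def by auto
  moreover have "rainbow c (star_on v {x, y, z})"
    using assms unfolding rainbow_def star_on_def by (auto simp: inj_on_def)
  ultimately show ?thesis
    unfolding rainbow_copies_def copies_star_graph by force
qed

lemma nsets_2D:
  assumes "e \<in> nsets A 2"
  obtains x y where "e = {x, y}" "x \<in> A" "y \<in> A" "x \<noteq> y"
  using assms unfolding nsets_def by (auto simp: card_2_iff)

text \<open>Three colours at a vertex would give a rainbow star, and the colour of the edge
  \<open>{u, w}\<close> is seen at both ends; hence the colour sets have a common element
  \<open>a\<close>. The conclusion says that each vertex sees at most one colour besides
  \<open>a\<close>.\<close>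

lemma rainbow_free_has_common_colour:
  assumes ex: "exact_coloring s (complete_graph n) c" and s: "4 \<le> s"
    and no: "rainbow_copies c (star_graph 3) (complete_graph n) = {}"
  obtains a where "\<And>v x y. v < n \<Longrightarrow> x < n \<Longrightarrow> y < n \<Longrightarrow> x \<noteq> v \<Longrightarrow> y \<noteq> v \<Longrightarrow>
      c {v, x} = a \<or> c {v, y} = a \<or> c {v, x} = c {v, y}"
    and "a \<in> {1..s}"
proof -
  define C where "C v = (\<lambda>x. c {v, x}) ` ({..<n} - {v})" for v
  have im: "c ` nsets {..<n} 2 = {1..s}"
    using ex unfolding exact_coloring_def complete_graph_def by simp
  have C_in: "c {v, x} \<in> C v" "c {v, x} \<in> C x" if "v < n" "x < n" "v \<noteq> x" for v x
    using that unfolding C_def by (auto simp: insert_commute)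
  have C_sub: "C v \<subseteq> {1..s}" if "v < n" for v
    using that unfolding C_def im[symmetric] by (auto simp: nsets_def)
  have no3: False if v: "v < n" "p \<in> C v" "q \<in> C v" "r \<in> C v" "p \<noteq> q" "p \<noteq> r" "q \<noteq> r" for v p q r
  proof -
    obtain x where x: "x < n" "x \<noteq> v" "p = c {v, x}" using v(2) unfolding C_def by auto
    obtain y where y: "y < n" "y \<noteq> v" "q = c {v, y}" using v(3) unfolding C_def by auto
    obtain z where z: "z < n" "z \<noteq> v" "r = c {v, z}" using v(4) unfolding C_def by auto
    show False using rainbow_star_3I[of v n x y z c] no v x y z by auto
  qed
  have le2: "card (C v) \<le> 2" if "v < n" for v
  proof (rule ccontr)
    assume "\<not> card (C v) \<le> 2"
    then have "3 \<le> card (C v)" by simp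
    then obtain D where "D \<subseteq> C v" "card D = 3" by (rule obtain_subset_with_card_n)
    then obtain p q r where "{p, q, r} \<subseteq> C v" "p \<noteq> q" "p \<noteq> r" "q \<noteq> r"
      by (metis card_3_iff)
    with no3[OF that, of p q r] show False by auto
  qed
  have U: "(\<Union>v\<in>{..<n}. C v) = {1..s}"
  proof (intro equalityI subsetI)
    fix j assume "j \<in> {1..s}"
    then obtain e where "e \<in> nsets {..<n} 2" "j = c e" unfolding im[symmetric] by blast
    then show "j \<in> (\<Union>v\<in>{..<n}. C v)" by (elim nsets_2D) (auto intro: C_in)
  qed (use C_sub in blast)
  have "nsets {..<n} 2 \<noteq> {}" using im s by auto
  then obtain e where "e \<in> nsets {..<n} 2" by blast
  then obtain x0 y0 where "x0 \<in> {..<n}" "y0 \<in> {..<n}" "x0 \<noteq> y0" by (rule nsets_2D)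
  then have xy0: "x0 < n" "y0 < n" "x0 \<noteq> y0" by simp_all
  have "\<exists>a. \<forall>w\<in>{..<n}. a \<in> C w"
  proof (rule common_element_of_intersecting_pairs)
    show "{..<n} \<noteq> {}" using xy0 by auto
    show "finite (C w)" for w unfolding C_def by auto
    show "card (C w) \<le> 2" if "w \<in> {..<n}" for w using le2 that by auto
    show "4 \<le> card (\<Union>w\<in>{..<n}. C w)" using U s by simp
    show "C u \<inter> C w \<noteq> {}" if uw: "u \<in> {..<n}" "w \<in> {..<n}" for u w
    proof (cases "u = w")
      case True
      \<comment> \<open>For \<open>u = w\<close> the claim is that \<open>C w\<close> is nonempty,
        which takes a second vertex: one of \<open>x0\<close>, \<open>y0\<close> differs from
        \<open>w\<close>.\<close>
      obtain x where "x < n" "x \<noteq> w" using xy0 by metis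
      then have "c {w, x} \<in> C w" using uw by (intro C_in) auto
      then show ?thesis using True by blast
    next
      case False
      then have "c {u, w} \<in> C u \<inter> C w" using C_in[of u w] uw by simp
      then show ?thesis by blast
    qed
  qed
  then obtain a where a: "\<And>w. w < n \<Longrightarrow> a \<in> C w" by auto
  show ?thesis
  proof (rule that)
    show "a \<in> {1..s}" using a[OF xy0(1)] C_sub[OF xy0(1)] by auto
    show "c {v, x} = a \<or> c {v, y} = a \<or> c {v, x} = c {v, y}"
      if "v < n" "x < n" "y < n" "x \<noteq> v" "y \<noteq> v" for v x y
      using no3[of v a "c {v, x}" "c {v, y}"] a[of v] C_in(1)[of v x] C_in(1)[of v y] that by auto
  qed
qed

section \<open>Embedding the multipartite graph in one colour\<close>

text \<open>Injectivity of \<open>\<phi>\<close> is enough, since the target is complete. The image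
  graph is given explicitly so that the colours of its edges can be read off.\<close>

lemma copies_embed:
  assumes S: "S \<in> copies H G" and inj: "inj_on \<phi> (verts G)"
    and V: "\<phi> ` verts G \<subseteq> {..<n}"
  shows "Graph (\<phi> ` verts S) ((`) \<phi> ` edges S) \<in> copies H (complete_graph n)"
proof -
  obtain f where sub: "simple_graph S" "verts S \<subseteq> verts G"
    and f: "bij_betw f (verts H) (verts S)" "(\<lambda>e. f ` e) ` edges H = edges S"
    using S unfolding copies_def subgraph_def graph_iso_def by auto
  have injS: "inj_on \<phi> (verts S)" using inj sub inj_on_subset by blast
  have E: "(`) \<phi> ` edges S \<subseteq> nsets (\<phi> ` verts S) 2"
  proof clarify
    fix e assume "e \<in> edges S"
    then have e: "e \<subseteq> verts S" "finite e" "card e = 2"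
      using sub unfolding simple_graph_def nsets_def by auto
    then show "\<phi> ` e \<in> nsets (\<phi> ` verts S) 2"
      using card_image[OF inj_on_subset[OF injS e(1)]] unfolding nsets_def by auto
  qed
  have Vn: "\<phi> ` verts S \<subseteq> {..<n}" using V sub by auto
  have "bij_betw (\<phi> \<circ> f) (verts H) (\<phi> ` verts S)"
    using f(1) injS by (meson bij_betw_trans inj_on_imp_bij_betw)
  moreover have "(\<lambda>e. (\<phi> \<circ> f) ` e) ` edges H = (`) \<phi> ` edges S"
    unfolding f(2)[symmetric] by (auto simp: image_image image_comp)
  ultimately have "graph_iso H (Graph (\<phi> ` verts S) ((`) \<phi> ` edges S))"
    unfolding graph_iso_def by (intro exI[of _ "\<phi> \<circ> f"]) auto
  moreover have "subgraph (Graph (\<phi> ` verts S) ((`) \<phi> ` edges S)) (complete_graph n)"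
    unfolding subgraph_def simple_graph_def complete_graph_def
    using E Vn nsets_mono[OF Vn, of 2] sub finite_subset[OF Vn] by auto
  ultimately show ?thesis unfolding copies_def by simp
qed

text \<open>Without a rainbow star, pick one edge of each colour other than the common colour
  \<open>a\<close>. These \<open>s - 1\<close> edges are disjoint and all edges between them have
  colour \<open>a\<close>, so their ends are the parts of a complete multipartite graph in colour
  \<open>a\<close>.\<close>

lemma rainbow_star_or_mono_copy:
  assumes ex: "exact_coloring s (complete_graph n) c" and s: "4 \<le> s"
    and H: "copies H (complete_multipartite (s - 1) 2) \<noteq> {}"
  shows "rainbow_copies c (star_graph 3) (complete_graph n) \<noteq> {} \<or>
    mono_copies c H (complete_graph n) \<noteq> {}"
proof (intro disjCI, rule ccontr)
  assume no_mono: "\<not> mono_copies c H (complete_graph n) \<noteq> {}"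
    and "\<not> rainbow_copies c (star_graph 3) (complete_graph n) \<noteq> {}"
  then obtain a where a: "\<And>v x y. v < n \<Longrightarrow> x < n \<Longrightarrow> y < n \<Longrightarrow> x \<noteq> v \<Longrightarrow> y \<noteq> v \<Longrightarrow>
      c {v, x} = a \<or> c {v, y} = a \<or> c {v, x} = c {v, y}" and as: "a \<in> {1..s}"
    using rainbow_free_has_common_colour[OF ex s] by metis
  have im: "c ` nsets {..<n} 2 = {1..s}"
    using ex unfolding exact_coloring_def complete_graph_def by simp
  define m where "m = s - 1"
  have "card ({1..s} - {a}) = card {..<m}" using as unfolding m_def by simp
  then obtain g where g: "bij_betw g {..<m} ({1..s} - {a})"
    using finite_same_card_bij[of "{..<m}" "{1..s} - {a}"] by auto
  have g_in: "g p \<in> {1..s}" "g p \<noteq> a" if "p < m" for p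
    using bij_betwE[OF g] that by auto
  have g_eq: "p = q" if "g p = g q" "p < m" "q < m" for p q
    using g that unfolding bij_betw_def inj_on_def by auto
  have "\<exists>x y. x < n \<and> y < n \<and> x \<noteq> y \<and> c {x, y} = g p" if p: "p < m" for p
  proof -
    have "g p \<in> c ` nsets {..<n} 2" unfolding im using p by (rule g_in)
    then obtain e where e: "e \<in> nsets {..<n} 2" "c e = g p" by fastforce
    from e(1) obtain x y where "e = {x, y}" "x \<in> {..<n}" "y \<in> {..<n}" "x \<noteq> y" by (rule nsets_2D)
    with e(2) show ?thesis by blast
  qed
  then obtain X Y where XY:
    "\<And>p. p < m \<Longrightarrow> X p < n \<and> Y p < n \<and> X p \<noteq> Y p \<and> c {X p, Y p} = g p" by metis
  \<comment> \<open>\<open>\<phi>\<close> sends the two vertices of part \<open>p\<close> to the two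
    ends of the edge chosen for colour \<open>g p\<close>; \<open>\<psi>\<close> gives the opposite
    end.\<close>
  define \<phi> where "\<phi> = (\<lambda>(p, i::nat). if i = 0 then X p else Y p)"
  define \<psi> where "\<psi> = (\<lambda>(p, i::nat). if i = 0 then Y p else X p)"
  define M where "M = {..<m} \<times> {..<2::nat}"
  have edge: "\<phi> u < n" "\<psi> u < n" "\<phi> u \<noteq> \<psi> u" "c {\<phi> u, \<psi> u} = g (fst u)" if "u \<in> M" for u
    using that XY[of "fst u"] unfolding M_def \<phi>_def \<psi>_def
    by (auto simp: insert_commute split: prod.splits)
  \<comment> \<open>A vertex shared by two chosen edges would see two distinct colours other than
    \<open>a\<close>.\<close>
  have ne: "\<phi> u \<noteq> \<phi> w" if "u \<in> M" "w \<in> M" "fst u \<noteq> fst w" for u w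
  proof
    assume eq: "\<phi> u = \<phi> w"
    have "c {\<phi> u, \<psi> u} = a \<or> c {\<phi> u, \<psi> w} = a \<or> c {\<phi> u, \<psi> u} = c {\<phi> u, \<psi> w}"
      using edge[OF that(1)] edge[OF that(2)] eq by (intro a) auto
    then have "g (fst u) = a \<or> g (fst w) = a \<or> g (fst u) = g (fst w)"
      using edge(4)[OF that(1)] edge(4)[OF that(2)] eq by auto
    then show False using g_in(2)[of "fst u"] g_in(2)[of "fst w"] g_eq that unfolding M_def by auto
  qed
  \<comment> \<open>A connecting edge of a colour other than \<open>a\<close> would have to share
    the colour of the chosen edge at each of its ends, but those two colours differ.\<close>
  have cross: "c {\<phi> u, \<phi> w} = a" if "u \<in> M" "w \<in> M" "fst u \<noteq> fst w" for u w
  proof (rule ccontr)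
    assume na: "c {\<phi> u, \<phi> w} \<noteq> a"
    have n: "\<phi> u \<noteq> \<phi> w" using ne that by auto
    have "c {\<phi> u, \<psi> u} = a \<or> c {\<phi> u, \<phi> w} = a \<or> c {\<phi> u, \<psi> u} = c {\<phi> u, \<phi> w}"
      using edge[OF that(1)] edge[OF that(2)] n by (intro a) auto
    moreover have "c {\<phi> w, \<psi> w} = a \<or> c {\<phi> w, \<phi> u} = a \<or> c {\<phi> w, \<psi> w} = c {\<phi> w, \<phi> u}"
      using edge[OF that(1)] edge[OF that(2)] n by (intro a) auto
    ultimately have "g (fst u) = a \<or> g (fst w) = a \<or> g (fst u) = g (fst w)"
      using edge(4)[OF that(1)] edge(4)[OF that(2)] na by (auto simp: insert_commute)
    then show False using g_in(2)[of "fst u"] g_in(2)[of "fst w"] g_eq that unfolding M_def by auto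
  qed
  have inj: "inj_on \<phi> M"
  proof (rule inj_onI)
    fix u w assume uw: "u \<in> M" "w \<in> M" "\<phi> u = \<phi> w"
    then have f: "fst u = fst w" using ne by blast
    have "X (fst u) \<noteq> Y (fst u)" using XY uw unfolding M_def by auto
    with f uw show "u = w" unfolding \<phi>_def M_def by (auto split: if_splits)
  qed
  define G where "G = complete_multipartite m 2"
  have G: "verts G = M"
    "edges G = {{u, w} |u w. u \<in> M \<and> w \<in> M \<and> fst u \<noteq> fst w}"
    unfolding G_def complete_multipartite_def M_def by auto
  obtain S where S: "S \<in> copies H G" using H unfolding G_def m_def by auto
  have "monochromatic c (Graph (\<phi> ` verts S) ((`) \<phi> ` edges S))"
    unfolding monochromatic_def
  proof (intro exI[of _ a] ballI)
    fix e assume "e \<in> edges (Graph (\<phi> ` verts S) ((`) \<phi> ` edges S))"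
    then obtain d where d: "d \<in> edges S" "e = \<phi> ` d" by auto
    then have "d \<in> edges G" using S unfolding copies_def subgraph_def by auto
    then obtain u w where "d = {u, w}" "u \<in> M" "w \<in> M" "fst u \<noteq> fst w" unfolding G by auto
    then show "c e = a" using cross d by auto
  qed
  moreover have "Graph (\<phi> ` verts S) ((`) \<phi> ` edges S) \<in> copies H (complete_graph n)"
    using S inj edge(1) by (intro copies_embed[where G = G]) (auto simp: G)
  ultimately show False
    using no_mono unfolding mono_copies_def by auto
qed

section \<open>Two more edges than colours\<close>

text \<open>\<open>R\<close> takes one edge of each colour, which leaves exactly the two edges
  \<open>e\<close> and \<open>f\<close>.\<close>

lemma two_surplus_representatives:
  assumes "finite E" "c ` E = {1..s}" "card E = s + 2"
  obtains R e f where "E = insert e (insert f R)" "e \<noteq> f" "inj_on c R" "c ` R = {1..s}"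
proof -
  obtain R where R: "R \<subseteq> E" "c ` R = {1..s}" "inj_on c R"
    using assms(2) by (metis subset_image_inj order_refl)
  have "card R = s" using card_image[OF R(3)] R(2) by simp
  then have "card (E - R) = 2"
    using assms R by (simp add: card_Diff_subset finite_subset)
  then obtain e f where "E - R = {e, f}" "e \<noteq> f" by (auto simp: card_2_iff)
  moreover from this have "E = insert e (insert f R)" using R by auto
  ultimately show ?thesis using that R by blast
qed

text \<open>A colour class has at most one member in the transversal \<open>R\<close>; only
  \<open>e\<close> and \<open>f\<close> can be added to it.\<close>

lemma card_colour_class_le_3:
  assumes "finite E" "c ` E = {1..s}" "card E = s + 2"
    and D: "D \<subseteq> E" "\<And>e. e \<in> D \<Longrightarrow> c e = i"
  shows "card D \<le> 3"
proof -
  obtain R e f where R: "E = insert e (insert f R)" "inj_on c R"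
    using two_surplus_representatives assms by metis
  have fin: "finite (D \<inter> R)" using D assms(1) finite_subset by blast
  have "card (D \<inter> R) \<le> Suc 0"
    unfolding card_le_Suc0_iff_eq[OF fin] using D R(2) unfolding inj_on_def by (metis IntE)
  moreover have "D \<subseteq> {e, f} \<union> (D \<inter> R)" using R D by auto
  then have "card D \<le> card ({e, f} \<union> (D \<inter> R))" using fin by (intro card_mono) auto
  moreover have "\<dots> \<le> card {e, f} + card (D \<inter> R)" by (rule card_Un_le)
  moreover have "card {e, f} \<le> 2" by (simp add: card_insert_if)
  ultimately show ?thesis by linarith
qed

text \<open>A monochromatic pair cannot lie inside \<open>R\<close>, so it is \<open>{e, f}\<close>
  or joins \<open>e\<close> or \<open>f\<close> to the unique member of \<open>R\<close> with the
  same colour.\<close>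

lemma mono_pairs_two_surplus:
  assumes "finite E" "c ` E = {1..s}" "card E = s + 2"
  obtains P where "card P \<le> 3" "finite P" "\<And>p. p \<in> P \<Longrightarrow> \<exists>x y. x \<noteq> y \<and> p = {x, y}"
    and "\<And>x y. x \<in> E \<Longrightarrow> y \<in> E \<Longrightarrow> x \<noteq> y \<Longrightarrow> c x = c y \<Longrightarrow> {x, y} \<in> P"
proof -
  obtain R e f where R: "E = insert e (insert f R)" "e \<noteq> f" "inj_on c R" "c ` R = {1..s}"
    using two_surplus_representatives assms by metis
  have cE: "c e \<in> c ` R" "c f \<in> c ` R" using R(1,4) assms(2) by auto
  then obtain e' f' where ef: "e' \<in> R" "c e' = c e" "f' \<in> R" "c f' = c f" by (metis imageE)
  have uniq: "x = y" if "x \<in> R" "y \<in> R" "c x = c y" for x y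
    using R(3) that unfolding inj_on_def by auto
  \<comment> \<open>The intersection keeps genuine pairs only: \<open>e \<notin> R\<close> and
    \<open>f \<notin> R\<close> are not among the facts obtained, so \<open>{e, e'}\<close> or
    \<open>{f, f'}\<close> might formally be a singleton. \<open>{e, f}\<close> stays in
    \<open>P\<close> even when it is not monochromatic, as only an upper bound is sought.\<close>
  define P where "P = {{e, f}, {e, e'}, {f, f'}} \<inter> {p. \<exists>x y. x \<noteq> y \<and> p = {x, y}}"
  show ?thesis
  proof (rule that[of P])
    have "card P \<le> card {{e, f}, {e, e'}, {f, f'}}" unfolding P_def by (intro card_mono) auto
    also have "\<dots> \<le> 3" by (simp add: card_insert_if)
    finally show "card P \<le> 3" .
    show "{x, y} \<in> P" if xy: "x \<in> E" "y \<in> E" "x \<noteq> y" "c x = c y" for x y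
    proof -
      have *: "{e, z} = {e, e'}" if "z \<in> R" "c z = c e" for z
        using uniq[of z e'] that ef by auto
      have **: "{f, z} = {f, f'}" if "z \<in> R" "c z = c f" for z
        using uniq[of z f'] that ef by auto
      have "{x, y} \<in> {{e, f}, {e, e'}, {f, f'}}"
      proof -
        consider "x \<in> R" "y \<in> R" | "{x, y} = {e, f}" | z where "z \<in> R" "c z = c e" "{x, y} = {e, z}"
          | z where "z \<in> R" "c z = c f" "{x, y} = {f, z}"
          using xy unfolding R(1) by (elim insertE) (simp_all add: insert_commute)
        then show ?thesis
        proof cases
          case 1
          then show ?thesis using uniq xy(3,4) by blast
        next
          case 2
          then show ?thesis by simp
        next
          case 3
          then show ?thesis using * by simp
        next
          case 4
          then show ?thesis using ** by simp
        qed
      qed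
      then show ?thesis using xy(3) unfolding P_def by blast
    qed
  qed (auto simp: P_def)
qed

text \<open>A monochromatic copy of \<open>H\<close> would put at least four edges into one colour
  class, which has at most three.\<close>

lemma mono_copies_empty_two_surplus:
  assumes ex: "exact_coloring s (complete_graph n) c" and s: "n choose 2 = s + 2"
    and H: "simple_graph H" "4 \<le> card (edges H)"
  shows "mono_copies c H (complete_graph n) = {}"
proof (rule ccontr)
  assume "mono_copies c H (complete_graph n) \<noteq> {}"
  then obtain S f i where S: "edges S \<subseteq> nsets {..<n} 2"
    and f: "bij_betw f (verts H) (verts S)" "(\<lambda>e. f ` e) ` edges H = edges S"
    and i: "\<And>e. e \<in> edges S \<Longrightarrow> c e = i"
    unfolding mono_copies_def copies_def subgraph_def graph_iso_def monochromatic_def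
      complete_graph_def by auto
  have "edges H \<subseteq> Pow (verts H)" using H unfolding simple_graph_def nsets_def by auto
  then have "inj_on (\<lambda>e. f ` e) (edges H)"
    using inj_on_subset[OF inj_on_image_Pow] f(1) unfolding bij_betw_def by blast
  then have "card (edges S) = card (edges H)" using f(2) card_image by metis
  moreover have "card (edges S) \<le> 3"
  proof (rule card_colour_class_le_3[of "nsets {..<n} 2"])
    show "c ` nsets {..<n} 2 = {1..s}"
      using ex unfolding exact_coloring_def complete_graph_def by simp
    show "finite (nsets {..<n} 2)" by (intro finite_imp_finite_nsets) auto
    show "card (nsets {..<n} 2) = s + 2" using s by (simp add: card_nsets)
  qed (use S i in auto)
  ultimately show False using H by simp
qed

section \<open>Counting rainbow and non-rainbow stars\<close>

text \<open>Rainbow stars are counted through their complement; the sum form avoids truncated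
  subtraction.\<close>

lemma card_rainbow_stars:
  assumes "2 \<le> m"
  shows "card (rainbow_copies c (star_graph m) (complete_graph n)) +
    card {(v, T) \<in> stars m n. \<not> rainbow c (star_on v T)} = n * ((n - 1) choose m)"
proof -
  define A where "A = {(v, T) \<in> stars m n. rainbow c (star_on v T)}"
  define B where "B = {(v, T) \<in> stars m n. \<not> rainbow c (star_on v T)}"
  have AB: "stars m n = A \<union> B" "A \<inter> B = {}" unfolding A_def B_def by auto
  have "rainbow_copies c (star_graph m) (complete_graph n) = (\<lambda>(v, T). star_on v T) ` A"
    unfolding rainbow_copies_def copies_star_graph A_def by auto
  moreover have "inj_on (\<lambda>(v, T). star_on v T) A"
    using inj_on_star_on[OF assms] AB(1) by (metis inj_on_Un)
  ultimately have "card (rainbow_copies c (star_graph m) (complete_graph n)) = card A"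
    by (simp add: card_image)
  moreover have "card A + card B = card (stars m n)"
    using AB finite_stars[of m n] by (metis card_Un_disjoint finite_Un)
  ultimately show ?thesis unfolding B_def card_stars by simp
qed

text \<open>Every non-rainbow star contains one of at most three monochromatic pairs, and each pair
  lies in at most \<open>n - 3\<close> stars.\<close>

lemma card_nonrainbow_stars_le:
  assumes ex: "exact_coloring s (complete_graph n) c" and s: "n choose 2 = s + 2"
  shows "card {(v, T) \<in> stars 3 n. \<not> rainbow c (star_on v T)} \<le> 3 * (n - 3)" (is "card ?B \<le> _")
proof -
  define E where "E = nsets {..<n} 2"
  have "c ` E = {1..s}" "finite E" "card E = s + 2"
    using ex s unfolding exact_coloring_def complete_graph_def E_def
    by (auto simp: finite_imp_finite_nsets card_nsets)
  then obtain P where P: "card P \<le> 3" "finite P" "\<And>p. p \<in> P \<Longrightarrow> \<exists>x y. x \<noteq> y \<and> p = {x, y}"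
    and mono: "\<And>x y. x \<in> E \<Longrightarrow> y \<in> E \<Longrightarrow> x \<noteq> y \<Longrightarrow> c x = c y \<Longrightarrow> {x, y} \<in> P"
    using mono_pairs_two_surplus by metis
  define Q where "Q p = {(v, T) \<in> stars 3 n. p \<subseteq> edges (star_on v T)}" for p
  have finQ: "finite (Q p)" for p unfolding Q_def using finite_stars by (rule finite_subset[rotated]) auto
  have "?B \<subseteq> (\<Union>p\<in>P. Q p)"
  proof clarify
    fix v T assume vT: "(v, T) \<in> stars 3 n" "\<not> rainbow c (star_on v T)"
    then obtain x y where xy: "x \<in> edges (star_on v T)" "y \<in> edges (star_on v T)" "x \<noteq> y" "c x = c y"
      unfolding rainbow_def inj_on_def by auto
    have "edges (star_on v T) \<subseteq> E"
      using vT(1) unfolding star_on_def stars_def nsets_def E_def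
      by (auto simp: card_insert_if subset_iff)
    then have "{x, y} \<in> P" using mono xy by auto
    then show "(v, T) \<in> (\<Union>p\<in>P. Q p)" using xy vT(1) unfolding Q_def by blast
  qed
  then have "card ?B \<le> card (\<Union>p\<in>P. Q p)" using P(2) finQ by (intro card_mono) auto
  also have "\<dots> \<le> (\<Sum>p\<in>P. card (Q p))" by (rule card_UN_le[OF P(2)])
  also have "\<dots> \<le> (\<Sum>p\<in>P. n - 3)"
  proof (rule sum_mono)
    fix p assume "p \<in> P"
    then show "card (Q p) \<le> n - 3"
      using P(3) card_stars_containing_two_edges unfolding Q_def by blast
  qed
  also have "\<dots> \<le> 3 * (n - 3)" using P(1) by simp
  finally show ?thesis .
qed

text \<open>The extremal colouring: the triangle on 0, 1, 2 gets colour 1, and the remaining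
  \<open>s - 1\<close> edges get the colours from 2 to \<open>s\<close> bijectively.\<close>

lemma exact_coloring_with_mono_triangle:
  assumes n: "3 \<le> n" and s: "n choose 2 = s + 2"
  obtains c where "exact_coloring s (complete_graph n) c"
    and "\<And>x y. x < 3 \<Longrightarrow> y < 3 \<Longrightarrow> x \<noteq> y \<Longrightarrow> c {x, y} = 1"
proof -
  define E where "E = nsets {..<n} 2"
  define D where "D = nsets {..<3::nat} 2"
  have DE: "D \<subseteq> E" unfolding D_def E_def using n by (intro nsets_mono) auto
  have fin: "finite E" unfolding E_def by (intro finite_imp_finite_nsets) auto
  have cD: "card D = 3" unfolding D_def by (simp add: card_nsets numeral_3_eq_3 numeral_2_eq_2)
  have cE: "card E = s + 2" unfolding E_def using s by (simp add: card_nsets)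
  have "card (E - D) = card {2..s}"
    using cD cE DE fin by (simp add: card_Diff_subset finite_subset)
  then obtain h where h: "bij_betw h (E - D) {2..s}"
    using fin finite_same_card_bij[of "E - D" "{2..s}"] by auto
  define c where "c = (\<lambda>e. if e \<in> D then 1 else h e)"
  have "s \<ge> 1" using cD cE DE fin card_mono[OF fin DE] by simp
  have "c ` E = c ` D \<union> c ` (E - D)" using DE by auto
  also have "c ` D = {1}"
  proof -
    have "D \<noteq> {}" using cD by auto
    then show ?thesis unfolding c_def by auto
  qed
  also have "c ` (E - D) = {2..s}" using h unfolding c_def bij_betw_def by auto
  also have "{1} \<union> {2..s} = {1..s}" using \<open>s \<ge> 1\<close> by auto
  finally have "exact_coloring s (complete_graph n) c"
    unfolding exact_coloring_def complete_graph_def E_def by simp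
  moreover have "c {x, y} = 1" if "x < 3" "y < 3" "x \<noteq> y" for x y
    using that unfolding c_def D_def nsets_def by auto
  ultimately show ?thesis using that by blast
qed

text \<open>Each triangle vertex, with the other two and one outside vertex as leaves, is the centre
  of a star with two edges of colour 1. These \<open>3 * (n - 3)\<close> stars are distinct.\<close>

lemma card_nonrainbow_stars_ge:
  assumes n: "3 \<le> n" and c: "\<And>x y. x < 3 \<Longrightarrow> y < 3 \<Longrightarrow> x \<noteq> y \<Longrightarrow> c {x, y} = 1"
  shows "3 * (n - 3) \<le> card {(v, T) \<in> stars 3 n. \<not> rainbow c (star_on v T)}" (is "_ \<le> card ?B")
proof -
  define F where "F = (\<lambda>(v::nat, z::nat). (v, insert z ({..<3} - {v})))"
  have "inj_on F ({..<3} \<times> {3..<n})"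
    unfolding F_def by (auto simp: inj_on_def insert_eq_iff)
  then have "card (F ` ({..<3} \<times> {3..<n})) = 3 * (n - 3)"
    by (simp add: card_image card_cartesian_product)
  moreover have "F ` ({..<3} \<times> {3..<n}) \<subseteq> ?B"
  proof
    fix u assume "u \<in> F ` ({..<3} \<times> {3..<n})"
    then obtain v z where u: "u = F (v, z)" and vz: "v \<in> {..<3}" "z \<in> {3..<n}" by auto
    define T where T: "T = insert z ({..<3} - {v})"
    have "card ({..<3} - {v}) = 2" using vz by simp
    then have "(v, T) \<in> stars 3 n"
      using vz n unfolding T stars_def nsets_def by (auto simp: card_insert_if)
    moreover from \<open>card ({..<3} - {v}) = 2\<close> obtain x y where xy: "{..<3} - {v} = {x, y}" "x \<noteq> y"
      unfolding card_2_iff by blast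
    then have "x \<in> {..<3} - {v}" "y \<in> {..<3} - {v}" by blast+
    then have cxy: "c {v, x} = c {v, y}" "{v, x} \<noteq> {v, y}"
      using c[of v x] c[of v y] vz(1) xy(2) by (auto simp: doubleton_eq_iff)
    moreover have "\<not> rainbow c (star_on v T)"
    proof -
      have "{v, x} \<in> edges (star_on v T)" "{v, y} \<in> edges (star_on v T)"
        unfolding star_on_def T xy(1) by auto
      then show ?thesis
        using cxy unfolding rainbow_def inj_on_def by blast
    qed
    ultimately show "u \<in> ?B" unfolding u F_def T by simp
  qed
  moreover have "finite ?B" using finite_stars by (rule finite_subset[rotated]) auto
  ultimately show ?thesis using card_mono[of ?B "F ` ({..<3} \<times> {3..<n})"] by linarith
qed

section \<open>The Gallai-Ramsey number and its multiplicity\<close>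

lemma binomial_mono_left:
  fixes m n :: nat
  assumes "m \<le> n"
  shows "m choose r \<le> n choose r"
  using assms
proof (induction rule: dec_induct)
  case (step i)
  then show ?case by (cases r) auto
qed simp

text \<open>The Ramsey property holds at every order, so only the existence of an exact colouring
  decides: \<open>t\<close> is the least order with at least \<open>s\<close> edges.\<close>

lemma gallai_ramsey_star_3:
  assumes s: "t choose 2 = s + 2" "4 \<le> s"
    and H: "copies H (complete_multipartite (s - 1) 2) \<noteq> {}"
  shows "gallai_ramsey s (star_graph 3) H = t"
  unfolding gallai_ramsey_def
proof (rule Least_equality)
  have t: "4 \<le> t"
  proof (rule ccontr)
    assume "\<not> 4 \<le> t"
    then have "t choose 2 \<le> 3 choose 2" by (intro binomial_mono_left) auto
    then show False using s by (simp add: numeral_3_eq_3 numeral_2_eq_2)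
  qed
  then have "3 \<le> t" by simp
  then obtain c where c: "exact_coloring s (complete_graph t) c"
    using exact_coloring_with_mono_triangle[OF _ s(1)] by blast
  show "(\<exists>c. exact_coloring s (complete_graph t) c) \<and>
    (\<forall>n\<ge>t. \<forall>c. exact_coloring s (complete_graph n) c \<longrightarrow>
      rainbow_copies c (star_graph 3) (complete_graph n) \<noteq> {} \<or>
      mono_copies c H (complete_graph n) \<noteq> {})"
    using rainbow_star_or_mono_copy[OF _ s(2) H] c by blast
  fix N assume "(\<exists>c. exact_coloring s (complete_graph N) c) \<and>
    (\<forall>n\<ge>N. \<forall>c. exact_coloring s (complete_graph n) c \<longrightarrow>
      rainbow_copies c (star_graph 3) (complete_graph n) \<noteq> {} \<or>
      mono_copies c H (complete_graph n) \<noteq> {})"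
  then obtain c where "c ` nsets {..<N} 2 = {1..s}"
    unfolding exact_coloring_def complete_graph_def by auto
  then have le: "s \<le> N choose 2"
    using card_image_le[OF finite_imp_finite_nsets[OF finite_lessThan], of c N 2]
    by (simp add: card_nsets)
  show "t \<le> N"
  proof (rule ccontr)
    assume "\<not> t \<le> N"
    then have "N choose 2 \<le> (t - 1) choose 2" by (intro binomial_mono_left) auto
    \<comment> \<open>Dropping a vertex loses \<open>t - 1 \<ge> 3\<close> edges, more than the
      surplus of two.\<close>
    moreover have "t choose 2 = ((t - 1) choose 2) + (t - 1)"
      using t by (cases t) (auto simp: numeral_2_eq_2)
    ultimately show False using le s t by linarith
  qed
qed

text \<open>Splits the number of all 3-stars into the claimed multiplicity and the maximal number
  \<open>3 * (t - 3)\<close> of non-rainbow stars.\<close>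

lemma star_count_identity:
  assumes "3 \<le> t"
  shows "t * ((t - 1) choose 3) = (t - 3) * ((t - 1) choose 3) + 3 * ((t - 3) choose 3)
    + 6 * ((t - 3) choose 2) + 3 * (t - 3)"
proof -
  obtain u where u: "t = u + 3" using assms by (metis le_add_diff_inverse2)
  \<comment> \<open>Pascal's rule applied twice; three times this equation supplies the coefficients
    3, 6 and 3.\<close>
  have "(Suc (Suc u)) choose 3 = (u choose 3) + 2 * (u choose 2) + u"
    by (simp add: numeral_3_eq_3 numeral_2_eq_2)
  then show ?thesis unfolding u by (simp add: algebra_simps)
qed

theorem theorem3p3:
  fixes k t :: nat and H :: "'a graph"
  assumes "k = t choose 2" and "k \<ge> 6"
    and "simple_graph H" and "no_isolated_vertices H"
    and "card (edges H) \<ge> 4"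
    and "copies H (complete_multipartite (k - 3) 2) \<noteq> {}"
  shows "gallai_ramsey_mult (k - 2) (star_graph 3) H =
    (if t = 4 then 1
     else if t = 5 then 14
     else (t - 3) * ((t - 1) choose 3) + 3 * ((t - 3) choose 3) + 6 * ((t - 3) choose 2))"
proof -
  define s where "s = k - 2"
  define N where
    "N = (t - 3) * ((t - 1) choose 3) + 3 * ((t - 3) choose 3) + 6 * ((t - 3) choose 2)"
  \<comment> \<open>\<open>s - 1\<close> counts the colours other than the common one, hence the
    parts of the multipartite graph.\<close>
  have s: "t choose 2 = s + 2" "4 \<le> s" "k - 3 = s - 1"
    using assms(1,2) unfolding s_def by auto
  have t: "3 \<le> t"
  proof (rule ccontr)
    assume "\<not> 3 \<le> t"
    then have "t choose 2 \<le> 2 choose 2" by (intro binomial_mono_left) auto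
    then show False using s by simp
  qed
  have gr: "gallai_ramsey s (star_graph 3) H = t"
    using gallai_ramsey_star_3[OF s(1,2)] assms(6) s(3) by metis
  let ?R = "\<lambda>c. card (rainbow_copies c (star_graph 3) (complete_graph t))"
  let ?B = "\<lambda>c. card {(v, T) \<in> stars 3 t. \<not> rainbow c (star_on v T)}"
  have count: "?R c + ?B c = N + 3 * (t - 3)" for c
    using card_rainbow_stars[of 3 c t] star_count_identity[OF t] unfolding N_def by simp
  have mono: "card (mono_copies c H (complete_graph t)) = 0"
    if "exact_coloring s (complete_graph t) c" for c
    using mono_copies_empty_two_surplus[OF that s(1) assms(3,5)] by simp
  have "gallai_ramsey_mult s (star_graph 3) H = N"
    unfolding gallai_ramsey_mult_def gr Let_def
  proof (rule Least_equality)
    obtain c where c: "exact_coloring s (complete_graph t) c"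
      "\<And>x y. x < 3 \<Longrightarrow> y < 3 \<Longrightarrow> x \<noteq> y \<Longrightarrow> c {x, y} = 1"
      using exact_coloring_with_mono_triangle[OF t s(1)] by metis
    \<comment> \<open>The triangle colouring attains the upper bound on non-rainbow stars, so it has
      exactly \<open>N\<close> rainbow ones.\<close>
    have "?B c = 3 * (t - 3)"
      using card_nonrainbow_stars_le[OF c(1) s(1)] card_nonrainbow_stars_ge[of t c, OF t c(2)] by simp
    then show "\<exists>c. exact_coloring s (complete_graph t) c \<and>
        N = ?R c + card (mono_copies c H (complete_graph t))"
      using c(1) count[of c] mono by auto
    show "N \<le> m" if m: "\<exists>c. exact_coloring s (complete_graph t) c \<and>
        m = ?R c + card (mono_copies c H (complete_graph t))" for m
    proof -
      obtain c where "exact_coloring s (complete_graph t) c" "?R c \<le> m" using m by auto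
      then show ?thesis using card_nonrainbow_stars_le[OF _ s(1), of c] count[of c] by linarith
    qed
  qed
  \<comment> \<open>The small cases are values of the same formula, in which some binomial
    coefficients vanish: 1 + 0 + 0 for \<open>t = 4\<close> and 8 + 0 + 6 for
    \<open>t = 5\<close>.\<close>
  moreover have "N = 1" if "t = 4" using that unfolding N_def by simp
  moreover have "N = 14" if "t = 5" using that unfolding N_def by (simp add: numeral_eq_Suc)
  ultimately show ?thesis unfolding N_def s_def by simp
qed

end
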